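(* Let $\nu\in\{0,1\}$, $n\in\mathbb{N}$, $g_0,\dots,g_n\in\mathbb{R}$, and let $$f(x)=(1+x)^{\nu}\sum_{k=0}^n g_k x^k(1+x^2)^{n-k},\qquad g(x)=\sum_{k=0}^n g_k x^k .$$ Then $f(x)$ is Hurwitz stable if and only if $g(x)$ is Hurwitz stable. In particular, if $f(x)$ is Hurwitz stable and its leading coefficient is positive, then $f(x)$ is semi-$\gamma$-positive.
   Context: A polynomial $f\in\mathbb{C}[x]$ is Hurwitz stable if it is identically zero or $f(x)\ne0$ whenever $\Re(x)>0$. A polynomial written in the form $f(x)=(1+x)^{\nu}\sum_{k=0}^n g_k x^k(1+x^2)^{n-k}$ with $\nu\in\{0,1\}$ is called semi-$\gamma$-positive if $g_k\ge 0$ for all $0\le k\le n$. *)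

theory Defs
  imports "HOL-Analysis.Analysis" "HOL-Computational_Algebra.Polynomial"
begin

definition hurwitz_stable :: "complex poly \<Rightarrow> bool" where
  "hurwitz_stable p \<longleftrightarrow> p = 0 \<or> (\<forall>z. Re z > 0 \<longrightarrow> poly p z \<noteq> 0)"

definition coeffs_poly :: "nat \<Rightarrow> (nat \<Rightarrow> 'a::comm_ring_1) \<Rightarrow> 'a poly" where
  "coeffs_poly n g = (\<Sum>k\<le>n. monom (g k) k)"

text \<open>
  The polynomial \<open>(1 + x)\<^sup>\<nu> \<Sum>k\<le>n. g\<^sub>k x\<^sup>k (1 + x\<^sup>2)\<^bsup>n - k\<^esup>\<close>.
\<close>

definition gamma_poly :: "nat \<Rightarrow> nat \<Rightarrow> (nat \<Rightarrow> 'a::comm_ring_1) \<Rightarrow> 'a poly" where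
  "gamma_poly \<nu> n g = [:1, 1:] ^ \<nu> * (\<Sum>k\<le>n. monom (g k) k * [:1, 0, 1:] ^ (n - k))"

text \<open>
  A nonzero real polynomial is \<open>gamma_poly \<nu> n g\<close> with \<open>\<nu> \<in> {0, 1}\<close> for at most one choice of
  \<open>\<nu>\<close>, \<open>n\<close> and \<open>g 0, \<dots>, g n\<close> (\<open>gamma_poly_unique\<close>), and for the zero polynomial every
  such \<open>g k\<close> is \<open>0\<close>, so the existential quantifiers below involve no choice:
  by \<open>semi_gamma_positive_gamma_poly\<close>, any given expansion decides the property.
\<close>

definition semi_gamma_positive :: "real poly \<Rightarrow> bool" where
  "semi_gamma_positive f \<longleftrightarrow>
     (\<exists>\<nu> n g. \<nu> \<in> {0, 1} \<and> f = gamma_poly \<nu> n g \<and> (\<forall>k\<le>n. 0 \<le> g k))"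

lemma coeff_coeffs_poly: "coeff (coeffs_poly n g) k = (if k \<le> n then g k else 0)"
  by (simp add: coeffs_poly_def coeff_sum)

lemma poly_gamma_poly:
  fixes x :: real
  shows "poly (gamma_poly \<nu> n g) x =
    (1 + x) ^ \<nu> * (1 + x\<^sup>2) ^ n * poly (coeffs_poly n g) (x / (1 + x\<^sup>2))"
proof -
  have nz: "1 + x\<^sup>2 \<noteq> 0"
    by (smt (verit) zero_le_power2)
  have "poly (gamma_poly \<nu> n g) x =
      (1 + x) ^ \<nu> * (\<Sum>k\<le>n. g k * x ^ k * (1 + x\<^sup>2) ^ (n - k))"
    by (simp add: gamma_poly_def poly_sum poly_monom power2_eq_square)
  also have "(\<Sum>k\<le>n. g k * x ^ k * (1 + x\<^sup>2) ^ (n - k)) =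
      (\<Sum>k\<le>n. (1 + x\<^sup>2) ^ n * (g k * (x / (1 + x\<^sup>2)) ^ k))"
    using nz by (intro sum.cong refl) (simp add: power_diff power_divide)
  finally show ?thesis
    by (simp add: coeffs_poly_def poly_sum poly_monom sum_distrib_left mult.assoc)
qed

lemma infinite_inversion_image: "infinite ((\<lambda>x::real. x / (1 + x\<^sup>2)) ` {0<..<1})"
proof -
  have "inj_on (\<lambda>x::real. x / (1 + x\<^sup>2)) {0<..<1}"
  proof (rule inj_onI)
    fix x y :: real
    assume xy: "x \<in> {0<..<1}" "y \<in> {0<..<1}" and eq: "x / (1 + x\<^sup>2) = y / (1 + y\<^sup>2)"
    have "1 + x\<^sup>2 \<noteq> 0" "1 + y\<^sup>2 \<noteq> 0"
      by (smt (verit) zero_le_power2)+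
    with eq have "x * (1 + y\<^sup>2) = y * (1 + x\<^sup>2)"
      by (simp add: frac_eq_eq)
    then have "(x - y) * (1 - x * y) = 0"
      by (simp add: algebra_simps power2_eq_square)
    moreover have "x * y < 1"
      using xy mult_strict_mono[of x 1 y 1] by simp
    ultimately show "x = y"
      by simp
  qed
  then show ?thesis
    using finite_imageD infinite_Ioo[of "0::real" 1] zero_less_one by blast
qed

lemma coeffs_poly_eqI:
  fixes g h :: "nat \<Rightarrow> real"
  assumes "\<And>x. 0 < x \<Longrightarrow>
    poly (coeffs_poly n g) (x / (1 + x\<^sup>2)) = poly (coeffs_poly n h) (x / (1 + x\<^sup>2))"
  assumes "k \<le> n"
  shows "g k = h k"
proof -
  let ?p = "coeffs_poly n g - coeffs_poly n h"
  have "(\<lambda>x::real. x / (1 + x\<^sup>2)) ` {0<..<1} \<subseteq> {x. poly ?p x = 0}"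
    using assms(1) by auto
  then have "?p = 0"
    using infinite_inversion_image poly_roots_finite finite_subset by metis
  then show ?thesis
    using assms(2) coeff_coeffs_poly[of n g k] coeff_coeffs_poly[of n h k] by simp
qed

lemma gamma_poly_eq_imp_eq:
  fixes g h :: "nat \<Rightarrow> real"
  assumes "gamma_poly \<nu> n g = gamma_poly \<nu> n h" "k \<le> n"
  shows "g k = h k"
proof (rule coeffs_poly_eqI[OF _ assms(2)])
  fix x :: real
  assume "0 < x"
  then have "1 + x \<noteq> 0" "1 + x\<^sup>2 \<noteq> 0"
    by (smt (verit) zero_le_power2)+
  then show "poly (coeffs_poly n g) (x / (1 + x\<^sup>2)) = poly (coeffs_poly n h) (x / (1 + x\<^sup>2))"
    using arg_cong[OF assms(1), of "\<lambda>p. poly p x"] by (simp add: poly_gamma_poly)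
qed

lemma gamma_poly_eq_0_imp:
  fixes g :: "nat \<Rightarrow> real"
  assumes "gamma_poly \<nu> n g = 0" "k \<le> n"
  shows "g k = 0"
proof -
  have "gamma_poly \<nu> n g = gamma_poly \<nu> n (\<lambda>_. 0)"
    using assms(1) by (simp add: gamma_poly_def)
  then show ?thesis
    using gamma_poly_eq_imp_eq assms(2) by blast
qed

lemma gamma_poly_reflect:
  fixes x :: real
  assumes "0 < x"
  shows "x ^ (\<nu> + 2 * n) * poly (gamma_poly \<nu> n g) (1 / x) = poly (gamma_poly \<nu> n g) x"
proof -
  have a: "x ^ \<nu> * (1 + 1 / x) ^ \<nu> = (1 + x) ^ \<nu>"
    using assms by (simp flip: power_mult_distrib add: field_simps)
  have b: "x ^ (2 * n) * (1 + (1 / x)\<^sup>2) ^ n = (1 + x\<^sup>2) ^ n"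
  proof -
    have "x\<^sup>2 * (1 + (1 / x)\<^sup>2) = 1 + x\<^sup>2"
      using assms by (simp add: distrib_left power_divide)
    then show ?thesis
      by (metis power_mult power_mult_distrib)
  qed
  have c: "(1 / x) / (1 + (1 / x)\<^sup>2) = x / (1 + x\<^sup>2)"
  proof -
    have "1 + (1 / x)\<^sup>2 = (1 + x\<^sup>2) / x\<^sup>2"
      using assms by (simp add: add_divide_distrib power_divide)
    then show ?thesis
      using assms by (simp add: power2_eq_square)
  qed
  have "x ^ (\<nu> + 2 * n) * poly (gamma_poly \<nu> n g) (1 / x) =
      (x ^ \<nu> * (1 + 1 / x) ^ \<nu>) * (x ^ (2 * n) * (1 + (1 / x)\<^sup>2) ^ n) *
      poly (coeffs_poly n g) ((1 / x) / (1 + (1 / x)\<^sup>2))"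
    by (simp only: poly_gamma_poly power_add mult_ac)
  then show ?thesis
    by (simp only: a b c poly_gamma_poly)
qed

lemma gamma_poly_unique:
  fixes g h :: "nat \<Rightarrow> real"
  assumes eq: "gamma_poly \<nu> n g = gamma_poly \<mu> m h"
    and nz: "gamma_poly \<nu> n g \<noteq> 0" and \<nu>: "\<nu> \<in> {0, 1}" and \<mu>: "\<mu> \<in> {0, 1}"
  shows "\<nu> = \<mu>" "n = m" "\<forall>k\<le>n. g k = h k"
proof -
  let ?f = "gamma_poly \<nu> n g"
  have "\<not> {1::real<..} \<subseteq> {x. poly ?f x = 0}"
    using finite_subset[OF _ poly_roots_finite[OF nz]] infinite_Ioi by blast
  then obtain x :: real where x: "x > 1" "poly ?f x \<noteq> 0"
    by auto
  have "x ^ (\<nu> + 2 * n) * poly ?f (1 / x) = poly ?f x"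
    using x gamma_poly_reflect[of x \<nu> n g] by simp
  moreover have "x ^ (\<mu> + 2 * m) * poly ?f (1 / x) = poly ?f x"
    using x gamma_poly_reflect[of x \<mu> m h] by (simp add: eq)
  ultimately have "x ^ (\<nu> + 2 * n) = x ^ (\<mu> + 2 * m)"
    using x(2) by (metis mult_cancel_right mult_zero_right)
  then have N: "\<nu> + 2 * n = \<mu> + 2 * m"
    using x(1) power_inject_exp by blast
  show 1: "\<nu> = \<mu>" and 2: "n = m"
    using N \<nu> \<mu> unfolding insert_iff empty_iff by presburger+
  show "\<forall>k\<le>n. g k = h k"
    using eq gamma_poly_eq_imp_eq unfolding 1 2 by blast
qed

lemma semi_gamma_positive_gamma_poly:
  assumes "\<nu> \<in> {0, 1}"
  shows "semi_gamma_positive (gamma_poly \<nu> n g) \<longleftrightarrow> (\<forall>k\<le>n. 0 \<le> g k)"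
proof (cases "gamma_poly \<nu> n g = 0")
  case True
  then have "\<forall>k\<le>n. 0 \<le> g k"
    using gamma_poly_eq_0_imp by (metis order_refl)
  then show ?thesis
    using assms unfolding semi_gamma_positive_def by blast
next
  case False
  show ?thesis
  proof
    assume "semi_gamma_positive (gamma_poly \<nu> n g)"
    then obtain \<mu> m h where h: "\<mu> \<in> {0, 1}" "gamma_poly \<nu> n g = gamma_poly \<mu> m h"
        "\<forall>k\<le>m. 0 \<le> h k"
      unfolding semi_gamma_positive_def by blast
    show "\<forall>k\<le>n. 0 \<le> g k"
      using gamma_poly_unique[OF h(2) False assms h(1)] h(3) by simp
  next
    assume "\<forall>k\<le>n. 0 \<le> g k"
    then show "semi_gamma_positive (gamma_poly \<nu> n g)"
      using assms unfolding semi_gamma_positive_def by blast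
  qed
qed

end

theory Submission
  imports Defs "HOL-Computational_Algebra.Fundamental_Theorem_Algebra"
begin

text \<open>
  If \<open>1 + z\<^sup>2 \<noteq> 0\<close> then \<open>f z = (1 + z)\<^sup>\<nu> (1 + z\<^sup>2)\<^sup>n g w\<close> with \<open>1 / w = z + 1 / z\<close>.  The real parts of
  \<open>z\<close> and \<open>1 / z\<close> have the same sign, so \<open>z \<mapsto> w\<close> maps the open right half plane onto itself, and
  stability transfers in both directions.  A real stable polynomial is a product of a constant and
  factors \<open>x - a\<close> (\<open>a \<le> 0\<close>) and \<open>x\<^sup>2 - 2 Re z x + \<bar>z\<bar>\<^sup>2\<close> (\<open>Re z \<le> 0\<close>), so its coefficients all
  have the sign of its leading coefficient; for \<open>g\<close> this sign is that of \<open>f\<close> at large reals.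
\<close>

section \<open>Embedding real polynomials into complex ones\<close>

lemma map_poly_of_real_add:
  "map_poly of_real (p + q) =
     (map_poly of_real p + map_poly of_real q :: 'a::{real_algebra_1,comm_ring_1} poly)"
  by (rule poly_eqI) (simp add: coeff_map_poly)

lemma map_poly_of_real_sum:
  "map_poly of_real (sum f A) =
     (\<Sum>k\<in>A. map_poly of_real (f k) :: 'a::{real_algebra_1,comm_ring_1} poly)"
  by (rule poly_eqI) (simp add: coeff_map_poly coeff_sum)

lemma map_poly_of_real_mult:
  "map_poly of_real (p * q) =
     (map_poly of_real p * map_poly of_real q :: 'a::{real_algebra_1,comm_ring_1} poly)"
  by (rule poly_eqI) (simp add: coeff_map_poly coeff_mult)

lemma map_poly_of_real_power:
  "map_poly of_real (p ^ n) =
     (map_poly of_real p ^ n :: 'a::{real_algebra_1,comm_ring_1} poly)"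
  by (induction n) (simp_all add: map_poly_of_real_mult)

lemma map_poly_of_real_monom:
  "map_poly of_real (monom c n) = (monom (of_real c) n :: 'a::{real_algebra_1,comm_ring_1} poly)"
  by (simp add: map_poly_monom)

lemmas map_poly_of_real_simps =
  map_poly_of_real_sum map_poly_of_real_mult map_poly_of_real_power map_poly_of_real_monom

lemma map_poly_of_real_coeffs_poly:
  "map_poly of_real (coeffs_poly n g) =
     (coeffs_poly n (\<lambda>k. of_real (g k)) :: 'a::{real_algebra_1,comm_ring_1} poly)"
  by (simp add: coeffs_poly_def map_poly_of_real_simps)

lemma map_poly_of_real_gamma_poly:
  "map_poly of_real (gamma_poly \<nu> n g) =
     (gamma_poly \<nu> n (\<lambda>k. of_real (g k)) :: 'a::{real_algebra_1,comm_ring_1} poly)"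
  by (simp add: gamma_poly_def map_poly_of_real_simps map_poly_pCons)

text \<open>Counterpart of \<open>poly_gamma_poly\<close> for complex arguments:
  \<open>1 + x\<^sup>2\<close> is positive over the reals, but it vanishes at the imaginary units
  and so has to be excluded by hypothesis.\<close>

lemma poly_gamma_poly_field:
  fixes x :: "'a::field"
  assumes "1 + x\<^sup>2 \<noteq> 0"
  shows "poly (gamma_poly \<nu> n g) x =
    (1 + x) ^ \<nu> * (1 + x\<^sup>2) ^ n * poly (coeffs_poly n g) (x / (1 + x\<^sup>2))"
proof -
  have "poly (gamma_poly \<nu> n g) x =
      (1 + x) ^ \<nu> * (\<Sum>k\<le>n. g k * x ^ k * (1 + x\<^sup>2) ^ (n - k))"
    by (simp add: gamma_poly_def poly_sum poly_monom power2_eq_square)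
  also have "(\<Sum>k\<le>n. g k * x ^ k * (1 + x\<^sup>2) ^ (n - k)) =
      (\<Sum>k\<le>n. (1 + x\<^sup>2) ^ n * (g k * (x / (1 + x\<^sup>2)) ^ k))"
    using assms by (intro sum.cong refl) (simp add: power_diff power_divide)
  finally show ?thesis
    by (simp add: coeffs_poly_def poly_sum poly_monom sum_distrib_left mult.assoc)
qed

section \<open>The map z / (1 + z^2) on the open right half plane\<close>

lemma Re_inverse_pos_iff: "Re (inverse z) > 0 \<longleftrightarrow> Re z > 0"
  \<comment> \<open>For nonzero \<open>z\<close> the inverse is the conjugate divided by the squared
    modulus; for \<open>z = 0\<close> both sides fail because \<open>inverse 0 = 0\<close>.\<close>
  by (cases "z = 0")
     (auto simp: zero_less_divide_iff complex_eq_iff sum_power2_gt_zero_iff not_sum_power2_lt_zero)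

lemma Re_add_inverse_pos_iff: "Re (z + inverse z) > 0 \<longleftrightarrow> Re z > 0"
proof (cases "Re z > 0")
  case True
  then show ?thesis
    using Re_inverse_pos_iff[of z] by simp
next
  case False
  then show ?thesis
    using Re_inverse_pos_iff[of z] by simp
qed

lemma inverse_add_inverse:
  fixes z :: complex
  assumes "z \<noteq> 0"
  shows "inverse (z + inverse z) = z / (1 + z\<^sup>2)"
proof -
  have "z + inverse z = (1 + z\<^sup>2) / z"
    using assms by (simp add: field_simps power2_eq_square)
  then show ?thesis
    by simp
qed

lemma right_half_plane_image:
  assumes "Re z > 0"
  shows "1 + z\<^sup>2 \<noteq> 0" "Re (z / (1 + z\<^sup>2)) > 0"
proof -
  have z: "z \<noteq> 0"
    using assms by auto
  have "Re (inverse (z + inverse z)) > 0"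
    using assms Re_inverse_pos_iff Re_add_inverse_pos_iff by blast
  then show "Re (z / (1 + z\<^sup>2)) > 0"
    by (simp only: inverse_add_inverse[OF z])
  \<comment> \<open>With a vanishing denominator the quotient would be 0, whose real part is not
    positive.\<close>
  then show "1 + z\<^sup>2 \<noteq> 0"
    by auto
qed

lemma right_half_plane_preimage:
  assumes "Re w > 0"
  obtains z where "Re z > 0" "z / (1 + z\<^sup>2) = w"
proof -
  define u where "u = inverse w"
  \<comment> \<open>A root of \<open>t\<^sup>2 - u * t + 1\<close>. The product of the roots is 1,
    so the other root \<open>u - z\<close> is \<open>inverse z\<close>. Either root would do, since
    the sign condition on \<open>Re z\<close> follows from that on \<open>Re u\<close>.\<close>
  define z where "z = (u + csqrt (u\<^sup>2 - 4)) / 2"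
  have "2 * z - u = csqrt (u\<^sup>2 - 4)"
    by (simp add: z_def field_simps)
  then have "(2 * z - u)\<^sup>2 = u\<^sup>2 - 4"
    by simp
  then have "4 * (z * (u - z)) = 4"
    by algebra
  then have "z * (u - z) = 1"
    by simp
  then have z: "z \<noteq> 0" "u - z = inverse z"
    by (auto simp: inverse_unique)
  then have u: "z + inverse z = inverse w"
    by (simp add: u_def algebra_simps)
  then have "Re z > 0"
    using assms Re_inverse_pos_iff Re_add_inverse_pos_iff by metis
  moreover have "z / (1 + z\<^sup>2) = w"
    using inverse_add_inverse[OF z(1)] u by simp
  ultimately show ?thesis
    using that by blast
qed

section \<open>Transfer of stability between the two polynomials\<close>

lemma gamma_poly_zeros_right_half_plane:
  fixes g :: "nat \<Rightarrow> complex"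
  shows "(\<forall>z. Re z > 0 \<longrightarrow> poly (gamma_poly \<nu> n g) z \<noteq> 0) \<longleftrightarrow>
         (\<forall>w. Re w > 0 \<longrightarrow> poly (coeffs_poly n g) w \<noteq> 0)"
proof -
  \<comment> \<open>The factors \<open>(1 + z) ^ \<nu>\<close> and
    \<open>(1 + z\<^sup>2) ^ n\<close> have no zeros in the open right half plane.\<close>
  have *: "poly (gamma_poly \<nu> n g) z = 0 \<longleftrightarrow> poly (coeffs_poly n g) (z / (1 + z\<^sup>2)) = 0"
    if "Re z > 0" for z
  proof -
    have "1 + z \<noteq> 0"
      using that by (auto simp: complex_eq_iff)
    then show ?thesis
      using right_half_plane_image(1)[OF that] by (simp add: poly_gamma_poly_field)
  qed
  show ?thesis
    using * right_half_plane_image(2) right_half_plane_preimage by metis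
qed

lemma map_poly_of_real_eq_0_iff [simp]:
  "map_poly complex_of_real p = 0 \<longleftrightarrow> p = 0"
  by (simp add: map_poly_eq_0_iff)

text \<open>Matches the two zero polynomials, which \<open>hurwitz_stable\<close> admits as a
  separate case.\<close>

lemma gamma_poly_eq_0_iff:
  fixes g :: "nat \<Rightarrow> real"
  shows "gamma_poly \<nu> n g = 0 \<longleftrightarrow> coeffs_poly n g = 0"
proof
  assume "gamma_poly \<nu> n g = 0"
  then show "coeffs_poly n g = 0"
    using gamma_poly_eq_0_imp by (intro poly_eqI) (simp add: coeff_coeffs_poly)
next
  assume "coeffs_poly n g = 0"
  then have "g k = 0" if "k \<le> n" for k
    using that coeff_coeffs_poly[of n g k] by simp
  then show "gamma_poly \<nu> n g = 0"
    by (simp add: gamma_poly_def)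
qed

theorem hurwitz_stable_gamma_poly_iff:
  "hurwitz_stable (map_poly complex_of_real (gamma_poly \<nu> n g)) \<longleftrightarrow>
   hurwitz_stable (map_poly complex_of_real (coeffs_poly n g))"
  unfolding hurwitz_stable_def map_poly_of_real_eq_0_iff gamma_poly_eq_0_iff
  unfolding map_poly_of_real_gamma_poly map_poly_of_real_coeffs_poly gamma_poly_zeros_right_half_plane ..

section \<open>Coefficient signs of stable real polynomials\<close>

lemma poly_map_poly_of_real:
  "poly (map_poly of_real p) (of_real x) = (of_real (poly p x) :: complex)"
  by (induction p) (simp_all add: map_poly_pCons)

text \<open>The quadratic is the product of \<open>x - z\<close> and its conjugate. The remainder
  modulo it is real, of degree at most 1, and vanishes at the nonreal \<open>z\<close>, hence is
  0.\<close>

lemma quadratic_dvd_of_nonreal_root: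
  assumes root: "poly (map_poly complex_of_real p) z = 0" and "Im z \<noteq> 0"
  shows "[:(cmod z)\<^sup>2, - 2 * Re z, 1:] dvd p"
proof -
  let ?q = "[:(cmod z)\<^sup>2, - 2 * Re z, 1:]"
  let ?r = "p mod ?q"
  have q: "poly (map_poly complex_of_real ?q) z = 0"
    by (simp add: map_poly_pCons complex_eq_iff cmod_power2[unfolded power2_eq_square]
        algebra_simps power2_eq_square)
  have "p = p div ?q * ?q + ?r"
    by (rule div_mult_mod_eq[symmetric])
  then have "poly (map_poly complex_of_real p) z = poly (map_poly complex_of_real (p div ?q)) z *
      poly (map_poly complex_of_real ?q) z + poly (map_poly complex_of_real ?r) z"
    by (metis map_poly_of_real_add map_poly_of_real_mult poly_add poly_mult)
  then have r: "poly (map_poly complex_of_real ?r) z = 0"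
    using root q by simp
  have "degree ?r \<le> 1"
    using degree_mod_less[of ?q p] by auto
  then have "?r = [:coeff ?r 0, coeff ?r 1:]"
    by (intro poly_eqI) (auto simp: coeff_pCons coeff_eq_0 split: nat.split)
  then obtain a b where ab: "?r = [:a, b:]"
    by blast
  with r \<open>Im z \<noteq> 0\<close> have "b = 0" "a = 0"
    by (auto simp: map_poly_pCons complex_eq_iff)
  with ab show ?thesis
    by (simp add: dvd_eq_mod_eq_0)
qed

lemma coeff_mult_nonneg:
  fixes p q :: "'a::linordered_idom poly"
  assumes "\<And>k. 0 \<le> coeff p k" "\<And>k. 0 \<le> coeff q k"
  shows "0 \<le> coeff (p * q) k"
  using assms by (simp add: coeff_mult sum_nonneg)

text \<open>Induction on the degree: a complex root yields a monic real factor \<open>d\<close> with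
  nonnegative coefficients, and the cofactor is stable with the same leading coefficient.\<close>

lemma hurwitz_stable_coeff_nonneg:
  assumes "hurwitz_stable (map_poly complex_of_real p)" "0 \<le> lead_coeff p"
  shows "0 \<le> coeff p k"
  using assms
proof (induction "degree p" arbitrary: p k rule: less_induct)
  case less
  show ?case
  proof (cases "degree p = 0")
    case True
    then show ?thesis
      using less.prems(2) by (cases "k = 0") (simp_all add: coeff_eq_0)
  next
    case False
    then have "degree (map_poly complex_of_real p) \<noteq> 0"
      by (simp add: degree_map_poly)
    then have "\<not> constant (poly (map_poly complex_of_real p))"
      by (simp add: constant_degree)
    then obtain z where z: "poly (map_poly complex_of_real p) z = 0"
      using fundamental_theorem_of_algebra by blast
    have p0: "p \<noteq> 0"
      using False by auto
    have Rez: "Re z \<le> 0"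
      using less.prems(1) z p0 by (auto simp: hurwitz_stable_def not_le[symmetric])
    \<comment> \<open>Linear for a real root, quadratic for a nonreal one;
      \<open>Re z \<le> 0\<close> gives the coefficient signs.\<close>
    obtain d where d: "d dvd p" "degree d > 0" "lead_coeff d = 1" "\<And>k. 0 \<le> coeff d k"
    proof (cases "Im z = 0")
      case True
      then have "z = of_real (Re z)"
        by (simp add: complex_eq_iff)
      then have "poly p (Re z) = 0"
        using z poly_map_poly_of_real[of p "Re z"] by simp
      then have "[:- Re z, 1:] dvd p"
        by (simp add: poly_eq_0_iff_dvd)
      then show ?thesis
        using Rez by (intro that) (auto simp: coeff_pCons split: nat.split)
    next
      case False
      then show ?thesis
        using Rez by (intro that[OF quadratic_dvd_of_nonreal_root[OF z]])
          (auto simp: coeff_pCons split: nat.split)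
    qed
    then obtain q where q: "p = d * q"
      by blast
    have "degree q < degree p"
      using q p0 d(2) by (simp add: degree_mult_eq)
    \<comment> \<open>Every root of \<open>q\<close> is a root of the nonzero
      \<open>p\<close>.\<close>
    moreover have "hurwitz_stable (map_poly complex_of_real q)"
      using less.prems(1) p0 unfolding hurwitz_stable_def q
      by (auto simp: map_poly_of_real_mult)
    moreover have "0 \<le> lead_coeff q"
      using less.prems(2) d(3) unfolding q by (simp add: lead_coeff_mult)
    ultimately have "0 \<le> coeff q k" for k
      using less.hyps by blast
    then show ?thesis
      unfolding q using d(4) coeff_mult_nonneg by blast
  qed
qed

lemma poly_nonneg_of_coeff_nonneg:
  fixes p :: "'a::linordered_idom poly"
  assumes "\<And>k. 0 \<le> coeff p k" "0 \<le> x"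
  shows "0 \<le> poly p x"
  using assms by (simp add: poly_altdef sum_nonneg)

text \<open>Otherwise \<open>- p\<close> would be stable with nonnegative coefficients, hence
  nonnegative at \<open>x\<close>.\<close>

lemma hurwitz_stable_lead_coeff_pos:
  assumes stable: "hurwitz_stable (map_poly complex_of_real p)"
    and "0 \<le> x" and pos: "0 < poly p x"
  shows "0 < lead_coeff p"
proof (rule ccontr)
  assume "\<not> 0 < lead_coeff p"
  then have lc: "0 \<le> lead_coeff (- p)"
    by simp
  have "map_poly complex_of_real (- p) = - map_poly complex_of_real p"
    by (rule poly_eqI) (simp add: coeff_map_poly)
  then have "hurwitz_stable (map_poly complex_of_real (- p))"
    using stable by (simp add: hurwitz_stable_def)
  then have "0 \<le> poly (- p) x"
    using hurwitz_stable_coeff_nonneg lc \<open>0 \<le> x\<close> by (blast intro: poly_nonneg_of_coeff_nonneg)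
  with pos show False
    by simp
qed

text \<open>The leading coefficient of \<open>gamma_poly \<nu> n g\<close> is the first nonzero
  \<open>g k\<close>, that of \<open>coeffs_poly n g\<close> the last. The sign is therefore carried
  over by a value at a positive point, the image of a large \<open>x\<close>.\<close>

lemma gamma_poly_lead_coeff_pos_imp:
  fixes g :: "nat \<Rightarrow> real"
  assumes "0 < lead_coeff (gamma_poly \<nu> n g)"
  obtains w where "0 < w" "0 < poly (coeffs_poly n g) w"
proof -
  obtain N where N: "\<And>x. N \<le> x \<Longrightarrow> lead_coeff (gamma_poly \<nu> n g) \<le> poly (gamma_poly \<nu> n g) x"
    using poly_pinfty_gt_lc[OF assms] by blast
  \<comment> \<open>The bound 1 keeps \<open>x\<close> positive even if \<open>N\<close> is
    not.\<close>
  define x where "x = max N 1"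
  have "0 < poly (gamma_poly \<nu> n g) x" "0 < x"
    using N[of x] assms by (simp_all add: x_def)
  moreover from \<open>0 < x\<close> have "0 < (1 + x) ^ \<nu> * (1 + x\<^sup>2) ^ n" "0 < x / (1 + x\<^sup>2)"
    by (simp_all add: add_pos_nonneg)
  ultimately show ?thesis
    using that by (simp add: poly_gamma_poly zero_less_mult_iff)
qed

theorem theorem4p3:
  fixes \<nu> n :: nat and g :: "nat \<Rightarrow> real"
  assumes "\<nu> \<in> {0, 1}"
  shows "(hurwitz_stable (map_poly complex_of_real (gamma_poly \<nu> n g)) \<longleftrightarrow>
            hurwitz_stable (map_poly complex_of_real (coeffs_poly n g))) \<and>
         (hurwitz_stable (map_poly complex_of_real (gamma_poly \<nu> n g)) \<longrightarrow>
            lead_coeff (gamma_poly \<nu> n g) > 0 \<longrightarrow>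
            semi_gamma_positive (gamma_poly \<nu> n g))"
proof (intro conjI impI)
  show "hurwitz_stable (map_poly complex_of_real (gamma_poly \<nu> n g)) \<longleftrightarrow>
      hurwitz_stable (map_poly complex_of_real (coeffs_poly n g))"
    by (rule hurwitz_stable_gamma_poly_iff)
next
  assume "hurwitz_stable (map_poly complex_of_real (gamma_poly \<nu> n g))"
  then have stable: "hurwitz_stable (map_poly complex_of_real (coeffs_poly n g))"
    by (simp only: hurwitz_stable_gamma_poly_iff)
  assume "lead_coeff (gamma_poly \<nu> n g) > 0"
  then obtain w where "0 < w" "0 < poly (coeffs_poly n g) w"
    by (rule gamma_poly_lead_coeff_pos_imp)
  then have "0 < lead_coeff (coeffs_poly n g)"
    by (intro hurwitz_stable_lead_coeff_pos[OF stable, of w]) simp_all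
  then have "0 \<le> coeff (coeffs_poly n g) k" for k
    using hurwitz_stable_coeff_nonneg[OF stable] by simp
  then have "\<forall>k\<le>n. 0 \<le> g k"
    by (metis coeff_coeffs_poly)
  then show "semi_gamma_positive (gamma_poly \<nu> n g)"
    using assms by (simp add: semi_gamma_positive_gamma_poly)
qed

end
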